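(* The equality $P'_{\varphi}(-\infty)=\alpha_{\min}$ holds if and only if there exists a sequence $x=(x_i)_{i=1}^\infty\in\Sigma_m$ such that $$\varphi(x_k,x_{k+1},\dots,x_{k+\ell-1})=\alpha_{\min}\qquad\text{for all }k\ge1.$$ Likewise, $P'_{\varphi}(+\infty)=\alpha_{\max}$ holds if and only if there exists a sequence $x=(x_i)_{i=1}^\infty\in\Sigma_m$ such that $$\varphi(x_k,x_{k+1},\dots,x_{k+\ell-1})=\alpha_{\max}\qquad\text{for all }k\ge1.$$
   Context: Let $m\ge 2$, $\ell\ge 2$, $q\ge 2$ be integers, $S=\{0,1,\dots,m-1\}$, and let $\Sigma_m$ be the space of sequences $x=(x_n)_{n\ge1}$ with $x_n\in S$. Let $\varphi:S^\ell\to\mathbb{R}$ be a function with $\alpha_{\min}<\alpha_{\max}$, where $\alpha_{\min}=\min_{S^\ell}\varphi$ and $\alpha_{\max}=\max_{S^\ell}\varphi$. For $s\in\mathbb{R}$ let $\psi_s:S^{\ell-1}\to(0,\infty)$ be the unique strictly positive function satisfying $$\psi_s(a_1,\dots,a_{\ell-1})^q=\sum_{j\in S}e^{s\varphi(a_1,\dots,a_{\ell-1},j)}\,\psi_s(a_2,\dots,a_{\ell-1},j)\qquad\text{for all }(a_1,\dots,a_{\ell-1})\in S^{\ell-1}.$$ Extend $\psi_s$ to $S^k$ for $1\le k\le \ell-2$, downwards in $k$, by $\psi_s(a)=\big(\sum_{j\in S}\psi_s(a,j)\big)^{1/q}$ for $a\in S^k$. The pressure function is $$P_\varphi(s)=(q-1)q^{\ell-2}\log\sum_{j\in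 S}\psi_s(j)\qquad(s\in\mathbb{R}),$$ where $\log$ is the natural logarithm; it is an analytic convex function on $\mathbb{R}$. Set $P'_\varphi(\pm\infty)=\lim_{s\to\pm\infty}P'_\varphi(s)$. *)

theory Defs
  imports "HOL-Analysis.Analysis"
begin

definition words :: "nat \<Rightarrow> nat \<Rightarrow> nat list set" where
  "words m k = {w. length w = k \<and> set w \<subseteq> {..<m}}"

text \<open>Sequences are indexed from 1; the value at 0 is irrelevant.\<close>

definition seqs :: "nat \<Rightarrow> (nat \<Rightarrow> nat) set" where
  "seqs m = {1..} \<rightarrow> {..<m}"

definition alpha_min :: "nat \<Rightarrow> nat \<Rightarrow> (nat list \<Rightarrow> real) \<Rightarrow> real" where
  "alpha_min m l \<phi> = Min (\<phi> ` words m l)"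

definition alpha_max :: "nat \<Rightarrow> nat \<Rightarrow> (nat list \<Rightarrow> real) \<Rightarrow> real" where
  "alpha_max m l \<phi> = Max (\<phi> ` words m l)"

text \<open>The extensional function space is used so that a function on the words of length
  \<open>l - 1\<close> is determined by its values there, as the definite description requires.\<close>

definition psi_top :: "nat \<Rightarrow> nat \<Rightarrow> nat \<Rightarrow> (nat list \<Rightarrow> real) \<Rightarrow> real \<Rightarrow> nat list \<Rightarrow> real" where
  "psi_top m l q \<phi> s =
     (THE f. f \<in> words m (l - 1) \<rightarrow>\<^sub>E {0<..} \<and>
       (\<forall>a \<in> words m (l - 1).
          f a ^ q = (\<Sum>j<m. exp (s * \<phi> (a @ [j])) * f (tl a @ [j]))))"

text \<open>\<open>psi_down d\<close> is the extension of \<open>\<psi>\<^sub>s\<close> to words of length \<open>l - 1 - d\<close>.\<close>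

fun psi_down ::
  "nat \<Rightarrow> nat \<Rightarrow> nat \<Rightarrow> nat \<Rightarrow> (nat list \<Rightarrow> real) \<Rightarrow> real \<Rightarrow> nat list \<Rightarrow> real" where
  "psi_down 0 m l q \<phi> s a = psi_top m l q \<phi> s a"
| "psi_down (Suc d) m l q \<phi> s a = root q (\<Sum>j<m. psi_down d m l q \<phi> s (a @ [j]))"

definition psi :: "nat \<Rightarrow> nat \<Rightarrow> nat \<Rightarrow> (nat list \<Rightarrow> real) \<Rightarrow> real \<Rightarrow> nat list \<Rightarrow> real" where
  "psi m l q \<phi> s a = psi_down (l - 1 - length a) m l q \<phi> s a"

definition pressure :: "nat \<Rightarrow> nat \<Rightarrow> nat \<Rightarrow> (nat list \<Rightarrow> real) \<Rightarrow> real \<Rightarrow> real" where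
  "pressure m l q \<phi> s = (real q - 1) * real q ^ (l - 2) * ln (\<Sum>j<m. psi m l q \<phi> s [j])"

end

theory Submission
  imports Defs
begin

text \<open>
  Write \<open>u = log \<psi>\<close> on the words of length \<open>l - 1\<close>, regarded as the vertices of a graph
  whose edges are the words of length \<open>l\<close>, weighted by \<open>\<phi>\<close>. The functional equation
  says that \<open>q * u a\<close> is the log-sum-exp, over the edges leaving \<open>a\<close>, of
  \<open>s * \<phi> + u\<close> at the end of the edge. Since \<open>q > 1\<close>, a maximum principle
  (\<open>max_principle\<close>) makes solutions of such equations unique and comparable, and convexity of
  log-sum-exp (\<open>lse_tangent\<close>) then shows that \<open>u\<close> is convex and differentiable in
  \<open>s\<close> (\<open>logpsi_has_tangents\<close>). Its derivative \<open>D\<close> satisfies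
  \<open>q * D a =\<close> the average of \<open>\<phi> + D\<close> over the edges leaving \<open>a\<close>. Hence
  \<open>D \<ge> \<alpha> / (q - 1)\<close>, where \<open>\<alpha>\<close> is the minimum of \<open>\<phi>\<close>. The pressure
  \<open>P\<close> is convex too, and \<open>P'\<close> is \<open>q - 1\<close> times a weighted average of
  \<open>D\<close> (\<open>pressure_has_tangents\<close>).

  Suppose some infinite path uses only edges of weight \<open>\<alpha>\<close>. Discarding all other edges
  along it bounds \<open>u\<close> from below and gives \<open>P s \<ge> s * \<alpha>\<close>. By convexity
  \<open>P s - s * P' s \<le> P 0\<close>, so \<open>\<alpha> \<le> P' s \<le> \<alpha> + P 0 / (- s)\<close> for
  \<open>s < 0\<close>, and \<open>P'\<close> tends to \<open>\<alpha>\<close> at \<open>-\<infinity>\<close>.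

  Conversely, let \<open>d a\<close> be the infimum of \<open>D a\<close> over all \<open>s\<close>. An average is at
  least a minimum, so some edge from \<open>a\<close> to some \<open>b\<close> has
  \<open>\<phi> + d b \<le> q * d a\<close>. If \<open>d a = \<alpha> / (q - 1)\<close> at one vertex, this edge has
  weight \<open>\<alpha>\<close> and \<open>d b\<close> is again \<open>\<alpha> / (q - 1)\<close>; repeating the choice gives an
  infinite path of weight \<open>\<alpha>\<close>. So without such a path \<open>P'\<close> stays above a constant
  larger than \<open>\<alpha>\<close> (\<open>minimal_path_or_slope_gap\<close>).

  The statement at \<open>+\<infinity>\<close> is the one at \<open>-\<infinity>\<close> for \<open>- \<phi>\<close>.
\<close>

section \<open>Log-sum-exp and its tangents\<close>

definition lse :: "'j set \<Rightarrow> ('j \<Rightarrow> real) \<Rightarrow> real" where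
  "lse J x = ln (\<Sum>j\<in>J. exp (x j))"

definition softmax :: "'j set \<Rightarrow> ('j \<Rightarrow> real) \<Rightarrow> 'j \<Rightarrow> real" where
  "softmax J x j = exp (x j) / (\<Sum>i\<in>J. exp (x i))"

lemma sum_exp_pos:
  fixes x :: "'j \<Rightarrow> real"
  assumes "finite J" "J \<noteq> {}"
  shows "0 < (\<Sum>j\<in>J. exp (x j))"
  using assms by (intro sum_pos) auto

lemma exp_lse:
  assumes "finite J" "J \<noteq> {}"
  shows "exp (lse J x) = (\<Sum>j\<in>J. exp (x j))"
  unfolding lse_def using sum_exp_pos[OF assms] by simp

lemma softmax_nonneg: "0 \<le> softmax J x j"
  unfolding softmax_def by (intro divide_nonneg_nonneg sum_nonneg) auto

lemma sum_softmax:
  assumes "finite J" "J \<noteq> {}"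
  shows "(\<Sum>j\<in>J. softmax J x j) = 1"
  unfolding softmax_def sum_divide_distrib[symmetric]
  using sum_exp_pos[OF assms, of x] by simp

lemma softmax_average_le:
  assumes "finite J" "J \<noteq> {}" "\<And>j. j \<in> J \<Longrightarrow> y j \<le> c"
  shows "(\<Sum>j\<in>J. softmax J x j * y j) \<le> c"
proof -
  have "(\<Sum>j\<in>J. softmax J x j * y j) \<le> (\<Sum>j\<in>J. softmax J x j * c)"
    using assms by (intro sum_mono mult_left_mono softmax_nonneg)
  also have "\<dots> = c"
    by (simp add: sum_distrib_right[symmetric] sum_softmax[OF assms(1,2)])
  finally show ?thesis .
qed

lemma le_softmax_average:
  assumes "finite J" "J \<noteq> {}" "\<And>j. j \<in> J \<Longrightarrow> c \<le> y j"
  shows "c \<le> (\<Sum>j\<in>J. softmax J x j * y j)"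
  using softmax_average_le[of J "\<lambda>j. - y j" "- c" x] assms by (simp add: sum_negf)

lemma softmax_average_le_some:
  assumes "finite J" "J \<noteq> {}"
  obtains j where "j \<in> J" "(\<Sum>j\<in>J. softmax J x j * y j) \<le> y j"
proof -
  have "Max (y ` J) \<in> y ` J" using assms by simp
  then obtain j where j: "j \<in> J" "y j = Max (y ` J)" by auto
  have "(\<Sum>j\<in>J. softmax J x j * y j) \<le> y j"
    using assms j by (intro softmax_average_le) auto
  with j(1) that show thesis by blast
qed

text \<open>Log-sum-exp is convex and its gradient is the softmax distribution, so it lies above its
  tangent planes; directly, this is Jensen's inequality in the form
  \<open>exp z \<ge> 1 + z\<close>, applied to the increments \<open>y j - x j\<close> centred at their
  softmax mean.\<close>
lemma lse_tangent:
  assumes "finite J" "J \<noteq> {}"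
  shows "lse J x + (\<Sum>j\<in>J. softmax J x j * (y j - x j)) \<le> lse J y"
proof -
  define A where "A = (\<Sum>j\<in>J. exp (x j))"
  define M where "M = (\<Sum>j\<in>J. softmax J x j * (y j - x j))"
  have A: "A > 0" unfolding A_def by (rule sum_exp_pos[OF assms])
  have "1 = (\<Sum>j\<in>J. softmax J x j) + M - (\<Sum>j\<in>J. softmax J x j) * M"
    by (simp add: sum_softmax[OF assms])
  also have "\<dots> = (\<Sum>j\<in>J. softmax J x j * (1 + ((y j - x j) - M)))"
    by (simp add: M_def distrib_left right_diff_distrib sum.distrib
        sum_subtractf sum_distrib_right[symmetric] sum_softmax[OF assms])
  also have "\<dots> \<le> (\<Sum>j\<in>J. softmax J x j * exp ((y j - x j) - M))"
    by (intro sum_mono mult_left_mono softmax_nonneg exp_ge_add_one_self)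
  also have "\<dots> = (\<Sum>j\<in>J. exp (y j)) / (A * exp M)"
    unfolding sum_divide_distrib using A
    by (intro sum.cong) (auto simp: softmax_def A_def[symmetric] exp_diff)
  finally have "A * exp M \<le> (\<Sum>j\<in>J. exp (y j))"
    using A by (simp add: field_simps)
  then have "ln (A * exp M) \<le> ln (\<Sum>j\<in>J. exp (y j))"
    using A sum_exp_pos[OF assms, of y] by simp
  then show ?thesis
    using A by (simp add: ln_mult lse_def A_def M_def)
qed

lemma lse_mono:
  assumes "finite J" "J \<noteq> {}" "\<And>j. j \<in> J \<Longrightarrow> x j \<le> y j"
  shows "lse J x \<le> lse J y"
proof -
  have "0 \<le> (\<Sum>j\<in>J. softmax J x j * (y j - x j))"
    using assms by (intro le_softmax_average) auto
  with lse_tangent[OF assms(1,2), of x y] show ?thesis by linarith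
qed

lemma le_lse:
  assumes "finite J" "j \<in> J"
  shows "x j \<le> lse J x"
proof -
  have "exp (x j) \<le> (\<Sum>j\<in>J. exp (x j))"
    using assms by (intro member_le_sum) auto
  also have "\<dots> = exp (lse J x)"
    using assms by (subst exp_lse) auto
  finally show ?thesis by simp
qed

lemma lse_le:
  assumes "finite J" "J \<noteq> {}" "\<And>j. j \<in> J \<Longrightarrow> x j \<le> c"
  shows "lse J x \<le> c + ln (card J)"
proof -
  have "lse J x \<le> lse J (\<lambda>_. c)" using assms by (intro lse_mono)
  also have "\<dots> = c + ln (card J)"
    using assms by (simp add: lse_def ln_mult card_gt_0_iff)
  finally show ?thesis .
qed

lemma tendsto_lse:
  assumes "finite J" "J \<noteq> {}" "\<And>j. j \<in> J \<Longrightarrow> ((\<lambda>t. x t j) \<longlongrightarrow> y j) F"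
  shows "((\<lambda>t. lse J (x t)) \<longlongrightarrow> lse J y) F"
  unfolding lse_def using assms sum_exp_pos[OF assms(1,2), of y]
  by (intro tendsto_intros) auto

lemma tendsto_softmax:
  assumes "finite J" "J \<noteq> {}" "\<And>j. j \<in> J \<Longrightarrow> ((\<lambda>t. x t j) \<longlongrightarrow> y j) F" "j \<in> J"
  shows "((\<lambda>t. softmax J (x t) j) \<longlongrightarrow> softmax J y j) F"
  unfolding softmax_def using assms sum_exp_pos[OF assms(1,2), of y]
  by (intro tendsto_intros) auto

text \<open>A differentiable convex function, presented by its derivative and its supporting lines.
  In this form convexity passes through log-sum-exp together with the derivative, and it can be
  evaluated at two parameters without any appeal to second derivatives.\<close>
definition has_tangents :: "(real \<Rightarrow> real) \<Rightarrow> (real \<Rightarrow> real) \<Rightarrow> bool" where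
  "has_tangents f f' \<longleftrightarrow>
     (\<forall>s. (f has_real_derivative f' s) (at s) \<and> (\<forall>t. f s + f' s * (t - s) \<le> f t))"

lemma has_tangents_cmult:
  assumes "has_tangents f f'" "0 \<le> c"
  shows "has_tangents (\<lambda>s. c * f s) (\<lambda>s. c * f' s)"
  unfolding has_tangents_def
proof (intro allI conjI)
  fix s t
  show "((\<lambda>s. c * f s) has_real_derivative c * f' s) (at s)"
    using assms(1) by (auto simp: has_tangents_def intro: DERIV_cmult)
  have "f s + f' s * (t - s) \<le> f t" using assms(1) by (auto simp: has_tangents_def)
  from mult_left_mono[OF this assms(2)]
  show "c * f s + c * f' s * (t - s) \<le> c * f t" by (simp add: algebra_simps)
qed

lemma has_tangents_lse:
  assumes "finite J" "J \<noteq> {}" "\<And>j. j \<in> J \<Longrightarrow> has_tangents (f j) (f' j)"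
  shows "has_tangents (\<lambda>s. lse J (\<lambda>j. f j s))
           (\<lambda>s. \<Sum>j\<in>J. softmax J (\<lambda>j. f j s) j * f' j s)"
  unfolding has_tangents_def
proof (intro allI conjI)
  fix s t
  have d: "(f j has_real_derivative f' j s) (at s)" if "j \<in> J" for j
    using assms(3)[OF that] by (simp add: has_tangents_def)
  show "((\<lambda>s. lse J (\<lambda>j. f j s)) has_real_derivative
          (\<Sum>j\<in>J. softmax J (\<lambda>j. f j s) j * f' j s)) (at s)"
    unfolding lse_def
    by (rule derivative_eq_intros d refl sum_exp_pos[OF assms(1,2)] | assumption)+
      (simp add: softmax_def sum_distrib_left sum_divide_distrib mult.commute)
  have "(\<Sum>j\<in>J. softmax J (\<lambda>j. f j s) j * f' j s) * (t - s)
      = (\<Sum>j\<in>J. softmax J (\<lambda>j. f j s) j * (f' j s * (t - s)))"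
    by (simp add: sum_distrib_right mult.assoc)
  also have "\<dots> \<le> (\<Sum>j\<in>J. softmax J (\<lambda>j. f j s) j * (f j t - f j s))"
  proof (intro sum_mono mult_left_mono softmax_nonneg)
    fix j assume "j \<in> J"
    from assms(3)[OF this] have "f j s + f' j s * (t - s) \<le> f j t"
      by (auto simp: has_tangents_def)
    then show "f' j s * (t - s) \<le> f j t - f j s" by linarith
  qed
  also have "\<dots> \<le> lse J (\<lambda>j. f j t) - lse J (\<lambda>j. f j s)"
    using lse_tangent[OF assms(1,2), of "\<lambda>j. f j s" "\<lambda>j. f j t"] by linarith
  finally show "lse J (\<lambda>j. f j s) + (\<Sum>j\<in>J. softmax J (\<lambda>j. f j s) j * f' j s) * (t - s)
      \<le> lse J (\<lambda>j. f j t)" by linarith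
qed

section \<open>Maximum principle and monotone iteration\<close>

text \<open>At a maximum point of \<open>f\<close> the hypothesis gives \<open>q * f a \<le> c + f a\<close>. Every
  comparison below (uniqueness of solutions, bounds, the tangent inequality, continuity of the
  derivative, the lower bound along a minimal path) is an instance for a suitable \<open>f\<close>.\<close>
lemma max_principle:
  fixes f :: "'v \<Rightarrow> real"
  assumes "finite A" "1 < q" "a \<in> A"
    and step: "\<And>a. a \<in> A \<Longrightarrow> \<exists>b\<in>A. q * f a \<le> c + f b"
  shows "f a \<le> c / (q - 1)"
proof -
  have "Max (f ` A) \<in> f ` A" using assms by (intro Max_in) auto
  then obtain z where z: "z \<in> A" "f z = Max (f ` A)" by auto
  have max: "f b \<le> f z" if "b \<in> A" for b using that z assms(1) by simp
  from step[OF z(1)] obtain b where "b \<in> A" "q * f z \<le> c + f b" by blast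
  with max[of b] have "(q - 1) * f z \<le> c" by (simp add: algebra_simps)
  then have "f z \<le> c / (q - 1)" using assms(2) by (simp add: field_simps)
  with max[OF assms(3)] show ?thesis by linarith
qed

text \<open>Iterating from the subsolution \<open>lo\<close> gives a sequence that increases and stays below
  the supersolution \<open>hi\<close>; its pointwise limit is fixed by continuity. It serves both the
  nonlinear equation for \<open>log \<psi>\<close> and the linear equation for its derivative.\<close>
lemma monotone_fixpoint:
  fixes T :: "('v \<Rightarrow> real) \<Rightarrow> 'v \<Rightarrow> real"
  assumes mono: "\<And>f g a. (\<And>b. b \<in> V \<Longrightarrow> f b \<le> g b) \<Longrightarrow> a \<in> V \<Longrightarrow> T f a \<le> T g a"
    and cont: "\<And>F g a. (\<And>b. b \<in> V \<Longrightarrow> (\<lambda>n. F n b) \<longlonglongrightarrow> g b) \<Longrightarrow> a \<in> V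
                \<Longrightarrow> (\<lambda>n. T (F n) a) \<longlonglongrightarrow> T g a"
    and lo: "\<And>a. a \<in> V \<Longrightarrow> lo \<le> T (\<lambda>_. lo) a"
    and hi: "\<And>a. a \<in> V \<Longrightarrow> T (\<lambda>_. hi) a \<le> hi"
    and "lo \<le> hi"
  shows "\<exists>f. \<forall>a\<in>V. T f a = f a"
proof -
  define F where "F n = (T ^^ n) (\<lambda>_. lo)" for n
  have FS: "F (Suc n) = T (F n)" for n by (simp add: F_def)
  have inc: "F n a \<le> F (Suc n) a" if "a \<in> V" for n a
    using that
  proof (induction n arbitrary: a)
    case 0 then show ?case using lo by (simp add: F_def)
  next
    case (Suc n) then show ?case unfolding FS[of "Suc n"] FS[of n] using mono FS[of n] by metis
  qed
  have bd: "F n a \<le> hi" if "a \<in> V" for n a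
    using that
  proof (induction n arbitrary: a)
    case 0 then show ?case using \<open>lo \<le> hi\<close> by (simp add: F_def)
  next
    case (Suc n)
    have "T (F n) a \<le> T (\<lambda>_. hi) a" using Suc by (intro mono) auto
    with hi[OF Suc.prems] show ?case unfolding FS by linarith
  qed
  define f where "f a = lim (\<lambda>n. F n a)" for a
  have lim: "(\<lambda>n. F n a) \<longlonglongrightarrow> f a" if a: "a \<in> V" for a
  proof -
    have "incseq (\<lambda>n. F n a)" using inc[OF a] by (rule incseq_SucI)
    then obtain L where "(\<lambda>n. F n a) \<longlonglongrightarrow> L"
      using incseq_convergent[of "\<lambda>n. F n a" hi] bd[OF a] by blast
    then show ?thesis unfolding f_def by (simp add: limI)
  qed
  have "T f a = f a" if "a \<in> V" for a
  proof (rule LIMSEQ_unique)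
    show "(\<lambda>n. T (F n) a) \<longlonglongrightarrow> T f a" using lim that by (rule cont)
    show "(\<lambda>n. T (F n) a) \<longlonglongrightarrow> f a"
      using LIMSEQ_Suc[OF lim[OF that]] by (simp add: FS)
  qed
  then show ?thesis by blast
qed

section \<open>The functional equation on a finite weighted graph\<close>

text \<open>A finite graph in which each vertex \<open>a\<close> has one edge \<open>a \<rightarrow> nxt a j\<close> of
  weight \<open>w a j\<close> for every label \<open>j\<close>. For the theorem the vertices are the words of length
  \<open>l - 1\<close> and the edges shift a word by one letter; the shape of the words does not enter
  the analysis of the functional equation.\<close>
locale weighted_system =
  fixes V :: "'v set" and J :: "'j set" and nxt :: "'v \<Rightarrow> 'j \<Rightarrow> 'v"
    and w :: "'v \<Rightarrow> 'j \<Rightarrow> real" and q :: real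
  assumes finV: "finite V" and finJ: "finite J" and neJ: "J \<noteq> {}"
    and nxt: "\<And>a j. a \<in> V \<Longrightarrow> j \<in> J \<Longrightarrow> nxt a j \<in> V"
    and q: "1 < q"
begin

definition K :: real where
  "K = (\<Sum>a\<in>V. \<Sum>j\<in>J. \<bar>w a j\<bar>)"

lemma abs_weight_le_K: "a \<in> V \<Longrightarrow> j \<in> J \<Longrightarrow> \<bar>w a j\<bar> \<le> K"
proof -
  assume a: "a \<in> V" "j \<in> J"
  have "\<bar>w a j\<bar> \<le> (\<Sum>j\<in>J. \<bar>w a j\<bar>)" using a finJ by (intro member_le_sum) auto
  also have "\<dots> \<le> K" unfolding K_def
    using a finV by (intro member_le_sum[of a V "\<lambda>a. \<Sum>j\<in>J. \<bar>w a j\<bar>"]) (auto intro: sum_nonneg)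
  finally show ?thesis .
qed

lemma K_nonneg: "0 \<le> K"
  unfolding K_def by (intro sum_nonneg) auto

text \<open>The functional equation of \<open>\<psi>\<close>, written for \<open>u = log \<psi>\<close>.\<close>
definition is_log_solution :: "real \<Rightarrow> ('v \<Rightarrow> real) \<Rightarrow> bool" where
  "is_log_solution s u \<longleftrightarrow> (\<forall>a\<in>V. q * u a = lse J (\<lambda>j. s * w a j + u (nxt a j)))"

text \<open>With \<open>B\<close> a bound for \<open>\<bar>s * w\<bar>\<close>, the constants below solve
  \<open>q * lo = - B + lo\<close> and \<open>q * hi = B + ln (card J) + hi\<close>, hence are a sub- and
  a supersolution.\<close>
lemma log_solution_exists: "\<exists>u. is_log_solution s u"
proof -
  define B where "B = \<bar>s\<bar> * K"
  have B0: "0 \<le> B" using K_nonneg by (simp add: B_def)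
  have B: "\<bar>s * w a j\<bar> \<le> B" if "a \<in> V" "j \<in> J" for a j
    unfolding B_def abs_mult using abs_weight_le_K[OF that] by (intro mult_left_mono) auto
  have card: "0 \<le> ln (card J)" using finJ neJ by (simp add: Suc_leI card_gt_0_iff)
  define T where "T u a = lse J (\<lambda>j. s * w a j + u (nxt a j)) / q" for u a
  have "\<exists>u. \<forall>a\<in>V. T u a = u a"
  proof (rule monotone_fixpoint[of V T "- B / (q - 1)" "(B + ln (card J)) / (q - 1)"])
    fix f g :: "'v \<Rightarrow> real" and a
    assume "\<And>b. b \<in> V \<Longrightarrow> f b \<le> g b" "a \<in> V"
    then show "T f a \<le> T g a"
      unfolding T_def using q nxt
      by (intro divide_right_mono lse_mono finJ neJ add_left_mono) auto
  next
    fix F :: "nat \<Rightarrow> 'v \<Rightarrow> real" and g a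
    assume "\<And>b. b \<in> V \<Longrightarrow> (\<lambda>n. F n b) \<longlonglongrightarrow> g b" "a \<in> V"
    then show "(\<lambda>n. T (F n) a) \<longlonglongrightarrow> T g a"
      unfolding T_def using q nxt
      by (intro tendsto_divide tendsto_lse finJ neJ tendsto_add tendsto_const) auto
  next
    fix a assume a: "a \<in> V"
    obtain j where j: "j \<in> J" using neJ by blast
    have "- B / (q - 1) = (- B + - B / (q - 1)) / q" using q by (simp add: field_simps)
    also have "\<dots> \<le> (s * w a j + - B / (q - 1)) / q"
      using B[OF a j] q by (intro divide_right_mono add_right_mono) auto
    also have "\<dots> \<le> T (\<lambda>_. - B / (q - 1)) a" unfolding T_def
      using q le_lse[OF finJ j, of "\<lambda>j. s * w a j + - B / (q - 1)"]
      by (intro divide_right_mono) auto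
    finally show "- B / (q - 1) \<le> T (\<lambda>_. - B / (q - 1)) a" .
  next
    fix a assume a: "a \<in> V"
    define h where "h = (B + ln (card J)) / (q - 1)"
    have "lse J (\<lambda>j. s * w a j + h) \<le> (B + h) + ln (card J)"
      using B[OF a] by (intro lse_le finJ neJ add_right_mono) (auto simp: abs_le_iff)
    also have "\<dots> = q * h" using q by (simp add: h_def field_simps)
    finally have "T (\<lambda>_. h) a \<le> h" unfolding T_def using q by (simp add: field_simps)
    then show "T (\<lambda>_. (B + ln (card J)) / (q - 1)) a \<le> (B + ln (card J)) / (q - 1)"
      unfolding h_def .
  next
    show "- B / (q - 1) \<le> (B + ln (card J)) / (q - 1)"
      using q B0 card by (intro divide_right_mono) auto
  qed
  then obtain u where u: "\<And>a. a \<in> V \<Longrightarrow> T u a = u a" by blast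
  have "is_log_solution s u"
    unfolding is_log_solution_def
  proof
    fix a assume "a \<in> V"
    from u[OF this] show "q * u a = lse J (\<lambda>j. s * w a j + u (nxt a j))"
      using q by (simp add: T_def field_simps)
  qed
  then show ?thesis by blast
qed

lemma log_solution_le:
  assumes "is_log_solution s u" "is_log_solution s v" "a \<in> V"
  shows "u a \<le> v a"
proof -
  have "u a - v a \<le> 0 / (q - 1)"
  proof (rule max_principle[OF finV q assms(3)])
    fix a assume a: "a \<in> V"
    let ?x = "\<lambda>j. s * w a j + u (nxt a j)" and ?y = "\<lambda>j. s * w a j + v (nxt a j)"
    obtain j where j: "j \<in> J" and
      "(\<Sum>j\<in>J. softmax J ?x j * (u (nxt a j) - v (nxt a j))) \<le> u (nxt a j) - v (nxt a j)"
      by (rule softmax_average_le_some[OF finJ neJ])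
    moreover have "lse J ?x - lse J ?y \<le> (\<Sum>j\<in>J. softmax J ?x j * (u (nxt a j) - v (nxt a j)))"
      using lse_tangent[OF finJ neJ, of ?x ?y]
      by (simp add: algebra_simps sum_subtractf)
    moreover have "q * (u a - v a) = lse J ?x - lse J ?y"
      using assms(1,2) a by (simp add: is_log_solution_def right_diff_distrib)
    ultimately show "\<exists>b\<in>V. q * (u a - v a) \<le> 0 + (u b - v b)"
      using nxt[OF a j] by (intro bexI[of _ "nxt a j"]) auto
  qed
  then show ?thesis by simp
qed

definition logpsi :: "real \<Rightarrow> 'v \<Rightarrow> real" where
  "logpsi s = (SOME u. is_log_solution s u)"

lemma logpsi_solution: "is_log_solution s (logpsi s)"
  unfolding logpsi_def using log_solution_exists by (rule someI_ex)

lemma logpsi: "a \<in> V \<Longrightarrow> q * logpsi s a = lse J (\<lambda>j. s * w a j + logpsi s (nxt a j))"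
  using logpsi_solution by (simp add: is_log_solution_def)

lemma logpsi_unique: "is_log_solution s u \<Longrightarrow> a \<in> V \<Longrightarrow> u a = logpsi s a"
  using log_solution_le[OF _ logpsi_solution] log_solution_le[OF logpsi_solution]
  by (metis order_antisym)

text \<open>The transition probabilities of the Markov chain that \<open>\<psi>\<close> induces on the graph.\<close>
definition p :: "real \<Rightarrow> 'v \<Rightarrow> 'j \<Rightarrow> real" where
  "p s a = softmax J (\<lambda>j. s * w a j + logpsi s (nxt a j))"

lemma slope_exists: "\<exists>D. \<forall>a\<in>V. q * D a = (\<Sum>j\<in>J. p s a j * (w a j + D (nxt a j)))"
proof -
  define T where "T D a = (\<Sum>j\<in>J. p s a j * (w a j + D (nxt a j))) / q" for D a
  have "\<exists>D. \<forall>a\<in>V. T D a = D a"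
  proof (rule monotone_fixpoint[of V T "- K / (q - 1)" "K / (q - 1)"])
    fix f g :: "'v \<Rightarrow> real" and a
    assume "\<And>b. b \<in> V \<Longrightarrow> f b \<le> g b" "a \<in> V"
    then show "T f a \<le> T g a"
      unfolding T_def p_def using q nxt
      by (intro divide_right_mono sum_mono mult_left_mono softmax_nonneg) auto
  next
    fix F :: "nat \<Rightarrow> 'v \<Rightarrow> real" and g a
    assume "\<And>b. b \<in> V \<Longrightarrow> (\<lambda>n. F n b) \<longlonglongrightarrow> g b" "a \<in> V"
    then show "(\<lambda>n. T (F n) a) \<longlonglongrightarrow> T g a"
      unfolding T_def using q nxt by (intro tendsto_intros) auto
  next
    fix a assume a: "a \<in> V"
    have "- K + - K / (q - 1) \<le> (\<Sum>j\<in>J. p s a j * (w a j + - K / (q - 1)))"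
      unfolding p_def
      using abs_weight_le_K[OF a] by (intro le_softmax_average finJ neJ add_right_mono) (force simp: abs_le_iff)
    moreover have "- K + - K / (q - 1) = q * (- K / (q - 1))" using q by (simp add: field_simps)
    ultimately show "- K / (q - 1) \<le> T (\<lambda>_. - K / (q - 1)) a"
      unfolding T_def using q by (simp add: pos_le_divide_eq mult.commute)
    have "(\<Sum>j\<in>J. p s a j * (w a j + K / (q - 1))) \<le> K + K / (q - 1)"
      unfolding p_def
      using abs_weight_le_K[OF a] by (intro softmax_average_le finJ neJ add_right_mono) (force simp: abs_le_iff)
    moreover have "K + K / (q - 1) = q * (K / (q - 1))" using q by (simp add: field_simps)
    ultimately show "T (\<lambda>_. K / (q - 1)) a \<le> K / (q - 1)"
      unfolding T_def using q by (simp add: pos_divide_le_eq mult.commute)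
  next
    show "- K / (q - 1) \<le> K / (q - 1)"
      using q K_nonneg by (intro divide_right_mono) auto
  qed
  then obtain D where D: "\<And>a. a \<in> V \<Longrightarrow> T D a = D a" by blast
  have "q * D a = (\<Sum>j\<in>J. p s a j * (w a j + D (nxt a j)))" if "a \<in> V" for a
    using D[OF that] q by (simp add: T_def field_simps)
  then show ?thesis by blast
qed

text \<open>The derivative of \<open>logpsi\<close> in \<open>s\<close>, introduced as a solution of the formally
  differentiated functional equation.\<close>
definition slope :: "real \<Rightarrow> 'v \<Rightarrow> real" where
  "slope s = (SOME D. \<forall>a\<in>V. q * D a = (\<Sum>j\<in>J. p s a j * (w a j + D (nxt a j))))"

lemma slope: "a \<in> V \<Longrightarrow> q * slope s a = (\<Sum>j\<in>J. p s a j * (w a j + slope s (nxt a j)))"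
  using someI_ex[OF slope_exists[of s]] unfolding slope_def by blast

lemma slope_ge_some:
  assumes "a \<in> V"
  obtains j where "j \<in> J" "w a j + slope s (nxt a j) \<le> q * slope s a"
proof -
  obtain j where "j \<in> J" "(\<Sum>j\<in>J. p s a j * - (w a j + slope s (nxt a j))) \<le> - (w a j + slope s (nxt a j))"
    unfolding p_def by (rule softmax_average_le_some[OF finJ neJ])
  moreover from this(2) have "w a j + slope s (nxt a j) \<le> q * slope s a"
    unfolding slope[OF assms] mult_minus_right sum_negf by linarith
  ultimately show thesis using that by blast
qed

lemma slope_le_some:
  assumes "a \<in> V"
  obtains j where "j \<in> J" "q * slope s a \<le> w a j + slope s (nxt a j)"
proof -
  obtain j where "j \<in> J" "(\<Sum>j\<in>J. p s a j * (w a j + slope s (nxt a j))) \<le> w a j + slope s (nxt a j)"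
    unfolding p_def by (rule softmax_average_le_some[OF finJ neJ])
  with slope[OF assms, of s] that show thesis by force
qed

lemma slope_lower:
  assumes "\<And>a j. a \<in> V \<Longrightarrow> j \<in> J \<Longrightarrow> \<alpha> \<le> w a j" "a \<in> V"
  shows "\<alpha> / (q - 1) \<le> slope s a"
proof -
  have "- slope s a \<le> - \<alpha> / (q - 1)"
  proof (rule max_principle[OF finV q assms(2)])
    fix a assume a: "a \<in> V"
    obtain j where "j \<in> J" "w a j + slope s (nxt a j) \<le> q * slope s a"
      by (rule slope_ge_some[OF a])
    then show "\<exists>b\<in>V. q * - slope s a \<le> - \<alpha> + - slope s b"
      using assms(1)[OF a, of j] nxt[OF a, of j] by (intro bexI[of _ "nxt a j"]) auto
  qed
  then show ?thesis by simp
qed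

lemma slope_upper:
  assumes "\<And>a j. a \<in> V \<Longrightarrow> j \<in> J \<Longrightarrow> w a j \<le> \<omega>" "a \<in> V"
  shows "slope s a \<le> \<omega> / (q - 1)"
proof (rule max_principle[OF finV q assms(2)])
  fix a assume a: "a \<in> V"
  obtain j where "j \<in> J" "q * slope s a \<le> w a j + slope s (nxt a j)"
    by (rule slope_le_some[OF a])
  then show "\<exists>b\<in>V. q * slope s a \<le> \<omega> + slope s b"
    using assms(1)[OF a, of j] nxt[OF a, of j] by (intro bexI[of _ "nxt a j"]) auto
qed

lemma abs_slope_le:
  assumes "a \<in> V"
  shows "\<bar>slope s a\<bar> \<le> K / (q - 1)"
proof -
  have w: "- K \<le> w a j" "w a j \<le> K" if "a \<in> V" "j \<in> J" for a j
    using abs_weight_le_K[OF that] by (auto simp: abs_le_iff)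
  show ?thesis
    using slope_lower[OF w(1) assms, of s] slope_upper[OF w(2) assms, of s] by (simp add: abs_le_iff)
qed

text \<open>The increment \<open>logpsi t - logpsi s\<close> is a supersolution, by convexity of
  log-sum-exp, of the linear equation that \<open>(t - s) * slope s\<close> solves. The maximum principle
  compares the two. This gives convexity before differentiability is known.\<close>
lemma logpsi_tangent:
  assumes "a \<in> V"
  shows "logpsi s a + slope s a * (t - s) \<le> logpsi t a"
proof -
  define f where "f a = slope s a * (t - s) - (logpsi t a - logpsi s a)" for a
  have "f a \<le> 0 / (q - 1)"
  proof (rule max_principle[OF finV q assms])
    fix a assume a: "a \<in> V"
    let ?x = "\<lambda>j. s * w a j + logpsi s (nxt a j)" and ?y = "\<lambda>j. t * w a j + logpsi t (nxt a j)"
    obtain j where j: "j \<in> J" and *: "(\<Sum>j\<in>J. p s a j * f (nxt a j)) \<le> f (nxt a j)"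
      unfolding p_def by (rule softmax_average_le_some[OF finJ neJ])
    have "q * f a = (q * slope s a) * (t - s) - (q * logpsi t a - q * logpsi s a)"
      by (simp add: f_def algebra_simps)
    also have "\<dots> \<le> (q * slope s a) * (t - s) - (\<Sum>j\<in>J. p s a j * (?y j - ?x j))"
      using lse_tangent[OF finJ neJ, of ?x ?y] by (simp add: logpsi[OF a] p_def)
    also have "\<dots> = (\<Sum>j\<in>J. p s a j * f (nxt a j))"
      unfolding slope[OF a] sum_distrib_right sum_subtractf[symmetric] f_def
      by (intro sum.cong) (auto simp: algebra_simps)
    finally show "\<exists>b\<in>V. q * f a \<le> 0 + f b"
      using * nxt[OF a j] by (intro bexI[of _ "nxt a j"]) auto
  qed
  then show ?thesis by (simp add: f_def)
qed

lemma logpsi_lipschitz: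
  assumes "a \<in> V"
  shows "\<bar>logpsi t a - logpsi s a\<bar> \<le> K / (q - 1) * \<bar>t - s\<bar>"
proof -
  have bd: "\<bar>slope r a * (t - s)\<bar> \<le> K / (q - 1) * \<bar>t - s\<bar>" for r
    unfolding abs_mult using abs_slope_le[OF assms] by (intro mult_right_mono) auto
  have "slope s a * (t - s) \<le> logpsi t a - logpsi s a"
    "logpsi t a - logpsi s a \<le> slope t a * (t - s)"
    using logpsi_tangent[OF assms, of s t] logpsi_tangent[OF assms, of t s]
    by (auto simp: algebra_simps)
  with bd[of s] bd[of t] show ?thesis by linarith
qed

lemma logpsi_continuous:
  assumes "a \<in> V"
  shows "((\<lambda>t. logpsi t a) \<longlongrightarrow> logpsi s a) (at s)"
proof -
  have "((\<lambda>t. logpsi t a - logpsi s a) \<longlongrightarrow> 0) (at s)"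
  proof (rule Lim_null_comparison)
    show "\<forall>\<^sub>F t in at s. norm (logpsi t a - logpsi s a) \<le> K / (q - 1) * \<bar>t - s\<bar>"
      using logpsi_lipschitz[OF assms] by simp
    show "((\<lambda>t. K / (q - 1) * \<bar>t - s\<bar>) \<longlongrightarrow> 0) (at s)"
      by (intro tendsto_mult_right_zero tendsto_rabs_zero LIM_zero tendsto_ident_at)
  qed
  then show ?thesis by (simp add: LIM_zero_iff)
qed

lemma p_continuous:
  assumes "a \<in> V" "j \<in> J"
  shows "((\<lambda>t. p t a j) \<longlongrightarrow> p s a j) (at s)"
  unfolding p_def using assms nxt
  by (intro tendsto_softmax finJ neJ tendsto_intros logpsi_continuous) auto

text \<open>The difference \<open>slope t - slope s\<close> solves the linear equation at \<open>t\<close> with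
  an error term that involves only the change of the transition probabilities, so the maximum
  principle bounds it by an expression that vanishes as \<open>t\<close> tends to \<open>s\<close>.\<close>
lemma slope_continuous:
  assumes "a \<in> V"
  shows "((\<lambda>t. slope t a) \<longlongrightarrow> slope s a) (at s)"
proof -
  define R where "R t a = (\<Sum>j\<in>J. \<bar>p t a j - p s a j\<bar> * \<bar>w a j + slope s (nxt a j)\<bar>)" for t a
  define \<epsilon> where "\<epsilon> t = (\<Sum>a\<in>V. R t a)" for t
  have R0: "0 \<le> R t a" for t a unfolding R_def by (intro sum_nonneg) auto
  have est: "\<bar>slope t a - slope s a\<bar> \<le> \<epsilon> t / (q - 1)" if "a \<in> V" for t a
  proof (rule max_principle[OF finV q that])
    fix a assume a: "a \<in> V"
    let ?d = "\<lambda>b. slope t b - slope s b"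
    obtain j where j: "j \<in> J" and *: "(\<Sum>j\<in>J. p t a j * \<bar>?d (nxt a j)\<bar>) \<le> \<bar>?d (nxt a j)\<bar>"
      unfolding p_def by (rule softmax_average_le_some[OF finJ neJ])
    have "q * ?d a = q * slope t a - q * slope s a" by (simp add: algebra_simps)
    also have "\<dots> = (\<Sum>j\<in>J. p t a j * ?d (nxt a j))
        + (\<Sum>j\<in>J. (p t a j - p s a j) * (w a j + slope s (nxt a j)))"
      unfolding slope[OF a] sum_subtractf[symmetric] sum.distrib[symmetric]
      by (intro sum.cong) (auto simp: algebra_simps)
    finally have "q * \<bar>?d a\<bar> = \<bar>(\<Sum>j\<in>J. p t a j * ?d (nxt a j))
        + (\<Sum>j\<in>J. (p t a j - p s a j) * (w a j + slope s (nxt a j)))\<bar>"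
      using q by (metis abs_mult abs_of_pos less_trans zero_less_one)
    also have "\<dots> \<le> (\<Sum>j\<in>J. \<bar>p t a j * ?d (nxt a j)\<bar>)
        + (\<Sum>j\<in>J. \<bar>(p t a j - p s a j) * (w a j + slope s (nxt a j))\<bar>)"
      by (intro order_trans[OF abs_triangle_ineq] add_mono sum_abs)
    also have "\<dots> = (\<Sum>j\<in>J. p t a j * \<bar>?d (nxt a j)\<bar>) + R t a"
      by (simp add: abs_mult R_def p_def softmax_nonneg)
    also have "R t a \<le> \<epsilon> t"
      unfolding \<epsilon>_def using a finV R0 by (intro member_le_sum[of a V "R t"]) auto
    finally show "\<exists>b\<in>V. q * \<bar>?d a\<bar> \<le> \<epsilon> t + \<bar>?d b\<bar>"
      using * nxt[OF a j] by (intro bexI[of _ "nxt a j"]) auto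
  qed
  have "((\<lambda>t. \<epsilon> t / (q - 1)) \<longlongrightarrow>
      (\<Sum>a\<in>V. \<Sum>j\<in>J. \<bar>p s a j - p s a j\<bar> * \<bar>w a j + slope s (nxt a j)\<bar>) / (q - 1)) (at s)"
    unfolding \<epsilon>_def R_def using q by (intro tendsto_intros p_continuous) auto
  then have lim: "((\<lambda>t. \<epsilon> t / (q - 1)) \<longlongrightarrow> 0) (at s)" by simp
  have "((\<lambda>t. slope t a - slope s a) \<longlongrightarrow> 0) (at s)"
    by (rule Lim_null_comparison[OF _ lim]) (use est[OF assms] in simp)
  then show ?thesis by (simp add: LIM_zero_iff)
qed

text \<open>The tangent inequalities at \<open>s\<close> and at \<open>t\<close> enclose the difference quotient
  between \<open>slope s\<close> and \<open>slope t\<close>, so differentiability reduces to continuity of the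
  slope.\<close>
lemma logpsi_has_tangents:
  assumes "a \<in> V"
  shows "has_tangents (\<lambda>s. logpsi s a) (\<lambda>s. slope s a)"
  unfolding has_tangents_def
proof (intro allI conjI)
  fix s t
  show "logpsi s a + slope s a * (t - s) \<le> logpsi t a" by (rule logpsi_tangent[OF assms])
  let ?Q = "\<lambda>t. (logpsi t a - logpsi s a) / (t - s)"
  have "norm (?Q t - slope s a) \<le> \<bar>slope t a - slope s a\<bar>" if "t \<noteq> s" for t
  proof -
    have 1: "slope s a * (t - s) \<le> logpsi t a - logpsi s a"
      and 2: "logpsi t a - logpsi s a \<le> slope t a * (t - s)"
      using logpsi_tangent[OF assms, of s t] logpsi_tangent[OF assms, of t s]
      by (auto simp: algebra_simps)
    show ?thesis
    proof (cases "s < t")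
      case True
      with 1 2 have "slope s a \<le> ?Q t" "?Q t \<le> slope t a"
        by (simp_all add: pos_le_divide_eq pos_divide_le_eq)
      then show ?thesis by simp
    next
      case False
      with that have "t - s < 0" by simp
      with 1 2 have "?Q t \<le> slope s a" "slope t a \<le> ?Q t"
        by (simp_all add: neg_le_divide_eq neg_divide_le_eq)
      then show ?thesis by simp
    qed
  qed
  then have "\<forall>\<^sub>F t in at s. norm (?Q t - slope s a) \<le> \<bar>slope t a - slope s a\<bar>"
    by (simp add: eventually_at_filter)
  moreover have "((\<lambda>t. \<bar>slope t a - slope s a\<bar>) \<longlongrightarrow> 0) (at s)"
    using slope_continuous[OF assms, of s] by (simp add: LIM_zero_iff tendsto_rabs_zero_iff)
  ultimately have "((\<lambda>t. ?Q t - slope s a) \<longlongrightarrow> 0) (at s)" by (rule Lim_null_comparison)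
  then show "((\<lambda>s. logpsi s a) has_real_derivative slope s a) (at s)"
    by (simp add: has_field_derivative_iff LIM_zero_iff)
qed

text \<open>Keeping only the edge of the path in the log-sum-exp gives
  \<open>q * logpsi s (b k) \<ge> s * \<alpha> + logpsi s (b (Suc k))\<close>; the maximum principle is applied on
  the vertices of the path.\<close>
lemma logpsi_lower_on_path:
  assumes "\<And>k. b k \<in> V" "\<And>k. j k \<in> J"
    and "\<And>k. b (Suc k) = nxt (b k) (j k)" "\<And>k. w (b k) (j k) = \<alpha>"
  shows "s * \<alpha> / (q - 1) \<le> logpsi s (b k)"
proof -
  have "- logpsi s (b k) \<le> - (s * \<alpha>) / (q - 1)"
  proof (rule max_principle[of "range b", OF _ q])
    show "finite (range b)" using finV assms(1) by (auto intro: finite_subset)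
  next
    fix a assume "a \<in> range b"
    then obtain i where i: "a = b i" by auto
    have "s * \<alpha> + logpsi s (b (Suc i)) \<le> q * logpsi s (b i)"
      using le_lse[OF finJ assms(2), of "\<lambda>j. s * w (b i) j + logpsi s (nxt (b i) j)" i]
      by (simp add: logpsi assms)
    then show "\<exists>c\<in>range b. q * - logpsi s a \<le> - (s * \<alpha>) + - logpsi s c"
      unfolding i by (intro bexI[of _ "b (Suc i)"]) auto
  qed auto
  then show ?thesis by simp
qed

text \<open>The infimum \<open>d a\<close> of the slopes over all \<open>s\<close> is a supersolution of the
  deterministic equation \<open>q * d a = (MIN j. w a j + d (nxt a j))\<close>, because an average is at
  least a minimum. If \<open>d a\<close> attains the least possible value \<open>\<alpha> / (q - 1)\<close>, then the
  minimising edge must have weight \<open>\<alpha>\<close> and lead to a vertex where that value is attained again,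
  and following such edges produces the path. Otherwise finitely many vertices leave a gap that is
  uniform in \<open>s\<close>.\<close>
lemma minimal_path_or_slope_gap:
  assumes \<alpha>: "\<And>a j. a \<in> V \<Longrightarrow> j \<in> J \<Longrightarrow> \<alpha> \<le> w a j" and "V \<noteq> {}"
  obtains (path) b j where "\<And>k. b k \<in> V" "\<And>k. j k \<in> J"
      "\<And>k. b (Suc k) = nxt (b k) (j k)" "\<And>k::nat. w (b k) (j k) = \<alpha>"
    | (gap) c where "\<alpha> / (q - 1) < c" "\<And>s a. a \<in> V \<Longrightarrow> c \<le> slope s a"
proof -
  define \<beta> where "\<beta> = \<alpha> / (q - 1)"
  have \<beta>: "q * \<beta> = \<alpha> + \<beta>" using q by (simp add: \<beta>_def field_simps)
  define d where "d a = (INF s. slope s a)" for a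
  have bdd: "bdd_below (range (\<lambda>s. slope s a))" if "a \<in> V" for a
    using slope_lower[OF \<alpha> that] by (intro bdd_belowI2[of _ "\<alpha> / (q - 1)"]) auto
  have d_le: "d a \<le> slope s a" if "a \<in> V" for s a
    unfolding d_def using bdd[OF that] by (intro cINF_lower) auto
  have \<beta>_le: "\<beta> \<le> d a" if "a \<in> V" for a
    unfolding d_def \<beta>_def using slope_lower[OF \<alpha> that] by (intro cINF_greatest) auto
  have greedy: "\<exists>j\<in>J. w a j = \<alpha> \<and> d (nxt a j) = \<beta>" if a: "a \<in> V" and da: "d a = \<beta>" for a
  proof -
    define \<mu> where "\<mu> = Min ((\<lambda>j. w a j + d (nxt a j)) ` J)"
    have "\<mu> / q \<le> d a"
      unfolding d_def
    proof (rule cINF_greatest)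
      fix s
      obtain j where j: "j \<in> J" "w a j + slope s (nxt a j) \<le> q * slope s a"
        by (rule slope_ge_some[OF a])
      have "\<mu> \<le> w a j + d (nxt a j)" unfolding \<mu>_def using finJ j(1) by simp
      with j d_le[OF nxt[OF a j(1)], of s] have "\<mu> \<le> q * slope s a" by linarith
      then show "\<mu> / q \<le> slope s a" using q by (simp add: field_simps)
    qed simp
    then have "\<mu> \<le> \<alpha> + \<beta>" using q \<beta> da by (simp add: field_simps)
    moreover have "\<mu> \<in> (\<lambda>j. w a j + d (nxt a j)) ` J"
      unfolding \<mu>_def using finJ neJ by (intro Min_in) auto
    ultimately obtain j where j: "j \<in> J" "w a j + d (nxt a j) \<le> \<alpha> + \<beta>" by auto
    from j \<alpha>[OF a j(1)] \<beta>_le[OF nxt[OF a j(1)]] have "w a j = \<alpha>" "d (nxt a j) = \<beta>"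
      by linarith+
    with j(1) show ?thesis by blast
  qed
  show thesis
  proof (cases "\<exists>a\<in>V. d a = \<beta>")
    case True
    then obtain a0 where a0: "a0 \<in> V" "d a0 = \<beta>" by blast
    from greedy obtain g where
      g: "\<And>a. a \<in> V \<Longrightarrow> d a = \<beta> \<Longrightarrow> g a \<in> J \<and> w a (g a) = \<alpha> \<and> d (nxt a (g a)) = \<beta>"
      by metis
    define b where "b k = ((\<lambda>a. nxt a (g a)) ^^ k) a0" for k
    have S: "b (Suc k) = nxt (b k) (g (b k))" for k by (simp add: b_def)
    have bk: "b k \<in> V \<and> d (b k) = \<beta>" for k
    proof (induction k)
      case 0 then show ?case using a0 by (simp add: b_def)
    next
      case (Suc k) then show ?case using g nxt by (simp add: S)
    qed
    show thesis
      by (rule path[of b "\<lambda>k. g (b k)"]) (use bk g S in auto)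
  next
    case False
    define c where "c = Min (d ` V)"
    have "c \<in> d ` V" unfolding c_def using finV \<open>V \<noteq> {}\<close> by simp
    with False \<beta>_le have "\<beta> < c" by force
    moreover have "c \<le> slope s a" if "a \<in> V" for s a
    proof -
      have "c \<le> d a" unfolding c_def using finV that by simp
      with d_le[OF that, of s] show ?thesis by linarith
    qed
    ultimately show thesis unfolding \<beta>_def by (rule gap)
  qed
qed

end

section \<open>The pressure of a function on words\<close>

lemma finite_words: "finite (words m k)"
proof -
  have "words m k = {w. set w \<subseteq> {..<m} \<and> length w = k}" by (auto simp: words_def)
  then show ?thesis using finite_lists_length_eq[of "{..<m}" k] by simp
qed

lemma words_not_empty: "0 < m \<Longrightarrow> words m k \<noteq> {}"
proof -
  assume "0 < m"
  then have "replicate k 0 \<in> words m k" by (auto simp: words_def)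
  then show ?thesis by blast
qed

lemma words_snoc: "a \<in> words m k \<Longrightarrow> j < m \<Longrightarrow> a @ [j] \<in> words m (Suc k)"
  by (auto simp: words_def)

lemma words_shift: "a \<in> words m k \<Longrightarrow> 0 < k \<Longrightarrow> j < m \<Longrightarrow> tl a @ [j] \<in> words m k"
  by (cases a) (auto simp: words_def)

locale word_potential =
  fixes m l q :: nat and \<phi> :: "nat list \<Rightarrow> real"
  assumes m: "2 \<le> m" and l: "2 \<le> l" and q2: "2 \<le> q"
begin

sublocale weighted_system "words m (l - 1)" "{..<m}" "\<lambda>a j. tl a @ [j]" "\<lambda>a j. \<phi> (a @ [j])" "real q"
proof
  show "{..<m} \<noteq> {}" using m by (auto simp: lessThan_empty_iff)
  show "tl a @ [j] \<in> words m (l - 1)" if "a \<in> words m (l - 1)" "j \<in> {..<m}" for a j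
    using that l by (intro words_shift) auto
qed (use q2 finite_words in auto)

lemma psi_top_eq:
  assumes "a \<in> words m (l - 1)"
  shows "psi_top m l q \<phi> s a = exp (logpsi s a)"
proof -
  let ?V = "words m (l - 1)"
  let ?f = "restrict (\<lambda>a. exp (logpsi s a)) ?V"
  have "psi_top m l q \<phi> s = ?f"
    unfolding psi_top_def
  proof (rule the_equality)
    have "exp (logpsi s a) ^ q = (\<Sum>j<m. exp (s * \<phi> (a @ [j])) * exp (logpsi s (tl a @ [j])))"
      if "a \<in> ?V" for a
      unfolding exp_of_nat_mult[symmetric] logpsi[OF that] exp_lse[OF finJ neJ] exp_add ..
    then show "?f \<in> ?V \<rightarrow>\<^sub>E {0<..} \<and>
        (\<forall>a\<in>?V. ?f a ^ q = (\<Sum>j<m. exp (s * \<phi> (a @ [j])) * ?f (tl a @ [j])))"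
      using nxt by auto
  next
    fix f assume f: "f \<in> ?V \<rightarrow>\<^sub>E {0<..} \<and>
        (\<forall>a\<in>?V. f a ^ q = (\<Sum>j<m. exp (s * \<phi> (a @ [j])) * f (tl a @ [j])))"
    then have pos: "0 < f a" if "a \<in> ?V" for a using that by auto
    have "is_log_solution s (\<lambda>a. ln (f a))"
      unfolding is_log_solution_def
    proof
      fix a assume a: "a \<in> ?V"
      have "real q * ln (f a) = ln (f a ^ q)"
        using pos[OF a] by (simp add: ln_realpow)
      also have "\<dots> = lse {..<m} (\<lambda>j. s * \<phi> (a @ [j]) + ln (f (tl a @ [j])))"
        using f a pos[OF nxt[OF a]] by (simp add: lse_def exp_add)
      finally show "real q * ln (f a) = lse {..<m} (\<lambda>j. s * \<phi> (a @ [j]) + ln (f (tl a @ [j])))" .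
    qed
    from logpsi_unique[OF this] have "f a = exp (logpsi s a)" if "a \<in> ?V" for a
      using that pos[OF that] by (metis exp_ln)
    then show "f = ?f" using f by (intro extensionalityI[of f ?V]) (auto simp: PiE_iff)
  qed
  then show ?thesis using assms by simp
qed

lemma psi_down_pos:
  "d \<le> l - 1 \<Longrightarrow> a \<in> words m (l - 1 - d) \<Longrightarrow> 0 < psi_down d m l q \<phi> s a"
proof (induction d arbitrary: a)
  case 0
  then show ?case by (simp add: psi_top_eq)
next
  case (Suc d)
  have "a @ [j] \<in> words m (l - 1 - d)" if "j < m" for j
    using words_snoc[OF Suc.prems(2) that] Suc.prems(1) by (simp add: Suc_diff_Suc)
  then have "0 < (\<Sum>j<m. psi_down d m l q \<phi> s (a @ [j]))"
    using Suc neJ by (intro sum_pos) auto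
  then show ?case using q2 by simp
qed

lemma ln_psi_down_Suc:
  assumes "Suc d \<le> l - 1" "a \<in> words m (l - 1 - Suc d)"
  shows "ln (psi_down (Suc d) m l q \<phi> s a)
       = (1 / q) * lse {..<m} (\<lambda>j. ln (psi_down d m l q \<phi> s (a @ [j])))"
proof -
  have "0 < psi_down d m l q \<phi> s (a @ [j])" if "j < m" for j
    using words_snoc[OF assms(2) that] assms(1)
    by (intro psi_down_pos) (simp_all add: Suc_diff_Suc)
  moreover from this have "0 < (\<Sum>j<m. psi_down d m l q \<phi> s (a @ [j]))"
    using neJ by (intro sum_pos) auto
  ultimately show ?thesis
    using q2 by (simp add: lse_def ln_root)
qed

text \<open>Each extension step takes a log-sum-exp and divides by \<open>q\<close>: it preserves convexity and
  differentiability, and the new derivative is an average of the old ones divided by \<open>q\<close>.\<close>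
lemma ln_psi_down_has_tangents:
  "d \<le> l - 1 \<Longrightarrow> a \<in> words m (l - 1 - d) \<Longrightarrow>
    \<exists>f'. has_tangents (\<lambda>s. ln (psi_down d m l q \<phi> s a)) f' \<and>
      (\<forall>s c. (\<forall>b\<in>words m (l - 1). c \<le> slope s b) \<longrightarrow> c / q ^ d \<le> f' s)"
proof (induction d arbitrary: a)
  case 0
  then show ?case
    using logpsi_has_tangents[of a] by (intro exI[of _ "\<lambda>s. slope s a"]) (simp add: psi_top_eq)
next
  case (Suc d)
  let ?F = "\<lambda>j s. ln (psi_down d m l q \<phi> s (a @ [j]))"
  have "\<forall>j\<in>{..<m}. \<exists>f'. has_tangents (?F j) f' \<and>
      (\<forall>s c. (\<forall>b\<in>words m (l - 1). c \<le> slope s b) \<longrightarrow> c / q ^ d \<le> f' s)"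
    using words_snoc[OF Suc.prems(2)] Suc.prems(1)
    by (intro ballI Suc.IH) (auto simp: Suc_diff_Suc)
  from bchoice[OF this] obtain F' where F': "\<And>j. j \<in> {..<m} \<Longrightarrow> has_tangents (?F j) (F' j)"
    and low: "\<And>j s c. j \<in> {..<m} \<Longrightarrow> (\<forall>b\<in>words m (l - 1). c \<le> slope s b) \<Longrightarrow> c / q ^ d \<le> F' j s"
    by blast
  define f' where "f' s = (\<Sum>j<m. softmax {..<m} (\<lambda>j. ?F j s) j * F' j s)" for s
  have "has_tangents (\<lambda>s. lse {..<m} (\<lambda>j. ?F j s)) f'"
    unfolding f'_def using F' by (rule has_tangents_lse[OF finJ neJ])
  from has_tangents_cmult[OF this, of "1 / q"]
  have "has_tangents (\<lambda>s. ln (psi_down (Suc d) m l q \<phi> s a)) (\<lambda>s. (1 / q) * f' s)"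
    by (simp only: ln_psi_down_Suc[OF Suc.prems]) simp
  moreover have "c / q ^ Suc d \<le> (1 / q) * f' s"
    if "\<forall>b\<in>words m (l - 1). c \<le> slope s b" for s c
  proof -
    have "c / q ^ d \<le> f' s"
      unfolding f'_def using low[OF _ that] by (intro le_softmax_average finJ neJ)
    then have "(1 / q) * (c / q ^ d) \<le> (1 / q) * f' s" by (intro mult_left_mono) auto
    then show ?thesis by (simp add: mult.commute)
  qed
  ultimately show ?case by blast
qed

lemma ln_psi_down_prefix_ge:
  assumes "a \<in> words m (l - 1)"
  shows "d \<le> l - 1 \<Longrightarrow> logpsi s a / q ^ d \<le> ln (psi_down d m l q \<phi> s (take (l - 1 - d) a))"
proof (induction d)
  case 0
  then show ?case using assms by (simp add: psi_top_eq words_def)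
next
  case (Suc d)
  let ?k = "l - 1 - Suc d"
  have k: "?k < length a" "Suc ?k = l - 1 - d" using assms Suc.prems by (auto simp: words_def)
  have pre: "take ?k a \<in> words m ?k"
    using assms by (auto simp: words_def dest: in_set_takeD)
  have last: "take ?k a @ [a ! ?k] = take (l - 1 - d) a"
    using take_Suc_conv_app_nth[OF k(1)] k(2) by simp
  have "a ! ?k \<in> {..<m}" using assms nth_mem[OF k(1)] by (auto simp: words_def)
  from le_lse[OF finJ this, of "\<lambda>j. ln (psi_down d m l q \<phi> s (take ?k a @ [j]))"]
  have "logpsi s a / q ^ d \<le> lse {..<m} (\<lambda>j. ln (psi_down d m l q \<phi> s (take ?k a @ [j])))"
    using Suc last by simp
  then have "(1 / q) * (logpsi s a / q ^ d)
      \<le> (1 / q) * lse {..<m} (\<lambda>j. ln (psi_down d m l q \<phi> s (take ?k a @ [j])))"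
    by (intro mult_left_mono) auto
  then show ?case
    unfolding ln_psi_down_Suc[OF Suc.prems pre] by (simp add: mult.commute)
qed

text \<open>Extending \<open>\<psi>\<close> one step further, to the empty word, turns the sum in the definition
  of the pressure into a \<open>q\<close>-th root, so that the pressure is a multiple of \<open>ln \<psi>\<close>
  at the empty word and the induction over the extension steps covers it.\<close>
lemma pressure_eq:
  "pressure m l q \<phi> s = ((real q - 1) * real q ^ (l - 1)) * ln (psi_down (l - 1) m l q \<phi> s [])"
proof -
  have l': "l - 1 = Suc (l - 2)" using l by simp
  have "0 < psi_down (l - 2) m l q \<phi> s [j]" if "j < m" for j
    using that l by (intro psi_down_pos) (auto simp: words_def)
  then have "0 < (\<Sum>j<m. psi_down (l - 2) m l q \<phi> s [j])"
    using neJ by (intro sum_pos) auto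
  then have "ln (psi_down (l - 1) m l q \<phi> s []) = ln (\<Sum>j<m. psi_down (l - 2) m l q \<phi> s [j]) / q"
    using q2 by (simp add: l' ln_root del: One_nat_def)
  moreover have "psi m l q \<phi> s [j] = psi_down (l - 2) m l q \<phi> s [j]" for j
    by (simp add: psi_def numeral_2_eq_2)
  ultimately show ?thesis using q2 by (simp add: pressure_def l' del: One_nat_def)
qed

lemma pressure_has_tangents:
  obtains P' where "has_tangents (pressure m l q \<phi>) P'"
    "\<And>s c. (\<And>b. b \<in> words m (l - 1) \<Longrightarrow> c \<le> slope s b) \<Longrightarrow> (real q - 1) * c \<le> P' s"
proof -
  obtain f' where f': "has_tangents (\<lambda>s. ln (psi_down (l - 1) m l q \<phi> s [])) f'"
    and low: "\<And>s c. (\<forall>b\<in>words m (l - 1). c \<le> slope s b) \<Longrightarrow> c / q ^ (l - 1) \<le> f' s"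
    using ln_psi_down_has_tangents[of "l - 1" "[]"] by (auto simp: words_def)
  define C where "C = (real q - 1) * real q ^ (l - 1)"
  have C: "0 \<le> C" using q2 by (simp add: C_def)
  have "has_tangents (pressure m l q \<phi>) (\<lambda>s. C * f' s)"
    using has_tangents_cmult[OF f' C] unfolding pressure_eq[abs_def] C_def .
  moreover have "(real q - 1) * c \<le> C * f' s" if "\<And>b. b \<in> words m (l - 1) \<Longrightarrow> c \<le> slope s b" for s c
  proof -
    have "(real q - 1) * c = C * (c / q ^ (l - 1))" using q2 by (simp add: C_def)
    also have "\<dots> \<le> C * f' s" using low that C by (intro mult_left_mono) auto
    finally show ?thesis .
  qed
  ultimately show thesis by (rule that)
qed

lemma pressure_ge_logpsi:
  assumes "a \<in> words m (l - 1)"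
  shows "(real q - 1) * logpsi s a \<le> pressure m l q \<phi> s"
proof -
  define C where "C = (real q - 1) * real q ^ (l - 1)"
  have C: "0 \<le> C" using q2 by (simp add: C_def)
  have "(real q - 1) * logpsi s a = C * (logpsi s a / q ^ (l - 1))" using q2 by (simp add: C_def)
  also have "\<dots> \<le> C * ln (psi_down (l - 1) m l q \<phi> s [])"
    using ln_psi_down_prefix_ge[OF assms, of "l - 1" s] C by (intro mult_left_mono) auto
  finally show ?thesis unfolding pressure_eq C_def .
qed

text \<open>Vertices overlap in all but one letter, so a path is the sequence of windows of the sequence of
  its first letters.\<close>
lemma sequence_of_path:
  assumes b: "\<And>k. b k \<in> words m (l - 1)" and j: "\<And>k. j k < m"
    and step: "\<And>k. b (Suc k) = tl (b k) @ [j k]" and val: "\<And>k::nat. \<phi> (b k @ [j k]) = \<alpha>"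
  shows "\<exists>x\<in>seqs m. \<forall>k\<ge>1. \<phi> (map x [k..<k + l]) = \<alpha>"
proof -
  define x where "x k = hd (b k)" for k
  have len: "length (b k) = l - 1" for k using b[of k] by (simp add: words_def)
  have nth: "i < l - 1 \<Longrightarrow> b k ! i = x (k + i)" for i k
  proof (induction i arbitrary: k)
    case 0
    then show ?case using len[of k] by (simp add: x_def hd_conv_nth flip: length_greater_0_conv)
  next
    case (Suc i)
    have "b (Suc k) ! i = b k ! Suc i"
      using Suc.prems len[of k] by (simp add: step nth_append nth_tl less_diff_conv)
    then show ?case using Suc by simp
  qed
  have "j k = x (k + (l - 1))" for k
  proof -
    have "j k = b (Suc k) ! (l - 2)" using len[of k] l by (simp add: step nth_append numeral_2_eq_2)
    also have "\<dots> = x (Suc k + (l - 2))" using l by (intro nth) auto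
    also have "Suc k + (l - 2) = k + (l - 1)" using l by simp
    finally show ?thesis .
  qed
  moreover have "b k = map x [k..<k + (l - 1)]" for k
    using len[of k] nth by (intro nth_equalityI) auto
  moreover have "[k..<k + l] = [k..<k + (l - 1)] @ [k + (l - 1)]" for k
    using upt_Suc_append[of k "k + (l - 1)"] l by simp
  ultimately have "map x [k..<k + l] = b k @ [j k]" for k by simp
  then have "\<forall>k\<ge>1. \<phi> (map x [k..<k + l]) = \<alpha>" using val by simp
  moreover have "x \<in> seqs m"
  proof -
    have "x k < m" for k
    proof -
      have "x k \<in> set (b k)" using len[of k] l by (auto simp: x_def intro!: hd_in_set)
      then show ?thesis using b[of k] by (auto simp: words_def)
    qed
    then show ?thesis by (auto simp: seqs_def)
  qed
  ultimately show ?thesis by blast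
qed

lemma path_of_sequence:
  assumes "x \<in> seqs m" "\<forall>k\<ge>1. \<phi> (map x [k..<k + l]) = \<alpha>"
  obtains b j where "\<And>k. b k \<in> words m (l - 1)" "\<And>k. j k < m"
    "\<And>k. b (Suc k) = tl (b k) @ [j k]" "\<And>k::nat. \<phi> (b k @ [j k]) = \<alpha>"
proof (rule that)
  let ?b = "\<lambda>k. map x [Suc k..<k + l]" and ?j = "\<lambda>k. x (k + l)"
  fix k
  have xm: "x i < m" if "1 \<le> i" for i using assms(1) that by (auto simp: seqs_def)
  show "?b k \<in> words m (l - 1)" using xm l by (auto simp: words_def)
  show "?j k < m" using xm l by simp
  have up: "[Suc k..<k + l] = Suc k # [Suc (Suc k)..<k + l]" using l by (simp add: upt_conv_Cons)
  show "?b (Suc k) = tl (?b k) @ [?j k]" unfolding up using l by simp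
  have "?b k @ [?j k] = map x [Suc k..<Suc k + l]" using l by simp
  then show "\<phi> (?b k @ [?j k]) = \<alpha>"
    using assms(2)[rule_format, of "Suc k"] by (simp only: le_add1 Suc_eq_plus1_left)
qed

lemma pressure_differentiable: "pressure m l q \<phi> differentiable at s"
proof -
  obtain P' where "has_tangents (pressure m l q \<phi>) P'" by (rule pressure_has_tangents)
  then show ?thesis
    by (auto simp: has_tangents_def real_differentiable_def)
qed

lemma deriv_pressure_at_bot_iff:
  "(deriv (pressure m l q \<phi>) \<longlongrightarrow> alpha_min m l \<phi>) at_bot \<longleftrightarrow>
    (\<exists>x \<in> seqs m. \<forall>k\<ge>1. \<phi> (map x [k..<k + l]) = alpha_min m l \<phi>)"
proof -
  define \<alpha> where "\<alpha> = alpha_min m l \<phi>"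
  have \<alpha>: "\<alpha> \<le> \<phi> (a @ [j])" if "a \<in> words m (l - 1)" "j \<in> {..<m}" for a j
    unfolding \<alpha>_def alpha_min_def
    using words_snoc[OF that(1), of j] that(2) l finite_words[of m l] by (intro Min_le) auto
  obtain P' where P': "has_tangents (pressure m l q \<phi>) P'"
    and low: "\<And>s c. (\<And>b. b \<in> words m (l - 1) \<Longrightarrow> c \<le> slope s b) \<Longrightarrow> (real q - 1) * c \<le> P' s"
    by (rule pressure_has_tangents) blast
  have deriv: "deriv (pressure m l q \<phi>) = P'"
    using P' by (auto simp: has_tangents_def intro!: ext DERIV_imp_deriv)
  have tangent: "pressure m l q \<phi> s + P' s * (0 - s) \<le> pressure m l q \<phi> 0" for s
    using P' unfolding has_tangents_def by blast
  have P'_ge: "\<alpha> \<le> P' s" for s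
  proof -
    have "(real q - 1) * (\<alpha> / (real q - 1)) \<le> P' s" using slope_lower[OF \<alpha>] by (intro low) auto
    then show ?thesis using q by simp
  qed
  show ?thesis
    unfolding deriv \<alpha>_def[symmetric]
  proof
    assume lim: "(P' \<longlongrightarrow> \<alpha>) at_bot"
    show "\<exists>x\<in>seqs m. \<forall>k\<ge>1. \<phi> (map x [k..<k + l]) = \<alpha>"
    proof (rule minimal_path_or_slope_gap)
      show "\<alpha> \<le> \<phi> (a @ [j])" if "a \<in> words m (l - 1)" "j \<in> {..<m}" for a j
        using that by (rule \<alpha>)
      show "words m (l - 1) \<noteq> {}" using m by (intro words_not_empty) auto
    next
      fix b j
      assume "\<And>k. b k \<in> words m (l - 1)" "\<And>k. j k \<in> {..<m}"
        "\<And>k. b (Suc k) = tl (b k) @ [j k]" "\<And>k::nat. \<phi> (b k @ [j k]) = \<alpha>"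
      then show ?thesis by (intro sequence_of_path[of b j]) auto
    next
      fix c
      assume c: "\<alpha> / (real q - 1) < c" "\<And>s a. a \<in> words m (l - 1) \<Longrightarrow> c \<le> slope s a"
      have "(real q - 1) * c \<le> \<alpha>"
        using lim by (rule tendsto_lowerbound) (use low c(2) in auto)
      with c(1) q show ?thesis by (simp add: field_simps)
    qed
  next
    assume "\<exists>x\<in>seqs m. \<forall>k\<ge>1. \<phi> (map x [k..<k + l]) = \<alpha>"
    then obtain x where x: "x \<in> seqs m" "\<forall>k\<ge>1. \<phi> (map x [k..<k + l]) = \<alpha>" by blast
    obtain b j where b: "\<And>k. b k \<in> words m (l - 1)" "\<And>k. j k < m"
      "\<And>k. b (Suc k) = tl (b k) @ [j k]" "\<And>k::nat. \<phi> (b k @ [j k]) = \<alpha>"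
      by (rule path_of_sequence[OF x]) blast
    have P_ge: "s * \<alpha> \<le> pressure m l q \<phi> s" for s
    proof -
      have "s * \<alpha> = (real q - 1) * (s * \<alpha> / (real q - 1))" using q by simp
      also have "\<dots> \<le> (real q - 1) * logpsi s (b 0)"
        using q logpsi_lower_on_path[of b j \<alpha> s 0] b by (intro mult_left_mono) auto
      also have "\<dots> \<le> pressure m l q \<phi> s" by (rule pressure_ge_logpsi[OF b(1)])
      finally show ?thesis .
    qed
    have up: "P' s \<le> \<alpha> + pressure m l q \<phi> 0 / (- s)" if "s < 0" for s
      using tangent[of s] P_ge[of s] that by (simp add: field_simps)
    show "(P' \<longlongrightarrow> \<alpha>) at_bot"
    proof (rule tendsto_sandwich)
      show "\<forall>\<^sub>F s in at_bot. \<alpha> \<le> P' s" using P'_ge by simp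
      show "\<forall>\<^sub>F s in at_bot. P' s \<le> \<alpha> + pressure m l q \<phi> 0 / (- s)"
        using eventually_gt_at_bot[of 0] by eventually_elim (rule up)
      have "((\<lambda>s::real. \<alpha> + pressure m l q \<phi> 0 / (- s)) \<longlongrightarrow> \<alpha> + 0) at_bot"
        by (intro tendsto_add tendsto_const tendsto_divide_0[OF tendsto_const]
            filterlim_at_top_imp_at_infinity filterlim_uminus_at_top_at_bot)
      then show "((\<lambda>s. \<alpha> + pressure m l q \<phi> 0 / (- s)) \<longlongrightarrow> \<alpha>) at_bot" by simp
    qed simp
  qed
qed

end

section \<open>Reflection and the two limits\<close>

text \<open>Only the products \<open>s * \<phi> a\<close> occur in the equation of \<open>\<psi>\<close>, so changing the
  sign of \<open>\<phi>\<close> reflects the pressure and exchanges the two halves of the theorem.\<close>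
lemma psi_down_uminus: "psi_down d m l q (\<lambda>a. - \<phi> a) s a = psi_down d m l q \<phi> (- s) a"
  by (induction d arbitrary: a) (simp_all add: psi_top_def)

lemma pressure_uminus: "pressure m l q (\<lambda>a. - \<phi> a) s = pressure m l q \<phi> (- s)"
  by (simp add: pressure_def psi_def psi_down_uminus)

lemma alpha_min_uminus:
  assumes "0 < m"
  shows "alpha_min m l (\<lambda>a. - \<phi> a) = - alpha_max m l \<phi>"
proof -
  have "- Max (\<phi> ` words m l) = Min (uminus ` \<phi> ` words m l)"
    using finite_words[of m l] words_not_empty[OF assms, of l]
    by (intro minus_Max_eq_Min) auto
  then show ?thesis by (simp add: alpha_min_def alpha_max_def image_image)
qed

theorem theorem1p2:
  fixes m l q :: nat and \<phi> :: "nat list \<Rightarrow> real"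
  assumes "m \<ge> 2" and "l \<ge> 2" and "q \<ge> 2"
    and "alpha_min m l \<phi> < alpha_max m l \<phi>"
  shows
    "((deriv (pressure m l q \<phi>) \<longlongrightarrow> alpha_min m l \<phi>) at_bot \<longleftrightarrow>
        (\<exists>x \<in> seqs m. \<forall>k\<ge>1. \<phi> (map x [k..<k + l]) = alpha_min m l \<phi>)) \<and>
     ((deriv (pressure m l q \<phi>) \<longlongrightarrow> alpha_max m l \<phi>) at_top \<longleftrightarrow>
        (\<exists>x \<in> seqs m. \<forall>k\<ge>1. \<phi> (map x [k..<k + l]) = alpha_max m l \<phi>))"
proof
  interpret word_potential m l q \<phi> using assms(1-3) by unfold_locales
  show "(deriv (pressure m l q \<phi>) \<longlongrightarrow> alpha_min m l \<phi>) at_bot \<longleftrightarrow>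
        (\<exists>x \<in> seqs m. \<forall>k\<ge>1. \<phi> (map x [k..<k + l]) = alpha_min m l \<phi>)"
    by (rule deriv_pressure_at_bot_iff)
  interpret neg: word_potential m l q "\<lambda>a. - \<phi> a" using assms(1-3) by unfold_locales
  have "deriv (pressure m l q (\<lambda>a. - \<phi> a)) s = - deriv (pressure m l q \<phi>) (- s)" for s
  proof -
    have "(pressure m l q \<phi> has_real_derivative deriv (pressure m l q \<phi>) (- s)) (at (- s))"
      using pressure_differentiable[of "- s"] by (simp add: DERIV_deriv_iff_real_differentiable)
    then have "((\<lambda>s. pressure m l q \<phi> (- s)) has_real_derivative - deriv (pressure m l q \<phi>) (- s)) (at s)"
      by (simp add: DERIV_mirror)
    then show ?thesis unfolding pressure_uminus[abs_def] by (rule DERIV_imp_deriv)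
  qed
  then have "(deriv (pressure m l q (\<lambda>a. - \<phi> a)) \<longlongrightarrow> - alpha_max m l \<phi>) at_bot
      \<longleftrightarrow> (deriv (pressure m l q \<phi>) \<longlongrightarrow> alpha_max m l \<phi>) at_top"
    by (simp add: filterlim_at_bot_mirror tendsto_minus_cancel_left[symmetric])
  then show "(deriv (pressure m l q \<phi>) \<longlongrightarrow> alpha_max m l \<phi>) at_top \<longleftrightarrow>
        (\<exists>x \<in> seqs m. \<forall>k\<ge>1. \<phi> (map x [k..<k + l]) = alpha_max m l \<phi>)"
    using neg.deriv_pressure_at_bot_iff assms(1) by (simp add: alpha_min_uminus)
qed

end
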